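(* Let $d\ge2$. Consider $m\ge1$ disjoint pairs of modes among $d$ modes, with the other $d-2m\ge0$ modes fixed in a number (computational-basis) state $|\mathbf x\rangle$: $$|\Psi\rangle=\bigotimes_{r=1}^m|\chi_r\rangle\otimes|\mathbf x\rangle,$$ where each pair state is either $|\chi_r\rangle=\alpha_r|10\rangle+\beta_r|01\rangle$ or $|\chi_r\rangle=\alpha_r|00\rangle+\beta_r|11\rangle$, with $|\alpha_r|^2+|\beta_r|^2=1$ and $\alpha_r\beta_r\ne0$. Then the certification walk of $|\Psi\rangle$ has spectrum $$\left\{1-\frac sc\ \middle|\ s=0,1,\dots,m\right\},\qquad c=\binom d2,$$ the eigenvalue $1-s/c$ having multiplicity $\binom ms$, independent of the $\alpha_r$ and $\beta_r$. In particular, the spectral gap is $$\gamma(L)=\frac1c=\frac{2}{d(d-1)}.$$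
   Context: Modes are identified with qubits (Jordan--Wigner), and number states with computational-basis states $|\mathbf x\rangle$, $\mathbf x\in\{0,1\}^d$. A state has definite parity $\sigma\in\{\pm1\}$ if it is an eigenvector of $Z^{\otimes d}$ with eigenvalue $\sigma$. **Certification walk.** For a target state $|\psi\rangle$ of definite parity let $\pi(\mathbf x)=|\langle\mathbf x|\psi\rangle|^2$, $V=\{\mathbf x:\pi(\mathbf x)>0\}$, and $E=\{(\mathbf x,\mathbf y)\in V\times V: |\mathbf x\oplus\mathbf y|=2\}$ (Hamming distance two). The certification walk is the Markov chain on $V$ with transition matrix $$\langle\mathbf x|P|\mathbf y\rangle=\begin{cases}\binom d2^{-1}\dfrac{\pi(\mathbf y)}{\pi(\mathbf x)+\pi(\mathbf y)},&(\mathbf x,\mathbf y)\in E,\\[2mm]\binom d2^{-1}\displaystyle\sum_{\mathbf x'\in\{0,1\}^d:\,|\mathbf x\oplus\mathbf x'|=2}\dfrac{\pi(\mathbf x)}{\pi(\mathbf x)+\pi(\mathbf x')},&\mathbf x=\mathbf y,\\[2mm]0,&\text{otherwise.}\end{cases}$$ **The operator $L$.** For a two-element subset $k\subset\{1,\dots,d\}$ and $\mathbf z^{(k)}\in\{0,1\}^{d-2}$ indexed by the complement of $k$, let $|\psi_{\mathbf z^{(k)}}\rangle$ be the normalized conditional state of $|\psi\rangle$ on the two qubits in $k$ after the other qubits are found in $|\mathbf z^{(k)}\rangle$. Then $L=\binom d2^{-1}\sum_k\sum_{\mathbf z^{(k)}}|\mathbf z^{(k)}\rangle\langle\mathbf z^{(k)}|\otimes|\psi_{\mathbf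 z^{(k)}}\rangle\langle\psi_{\mathbf z^{(k)}}|$, summing only over branches of nonzero probability. $L$ restricted to the span of $\{|\mathbf x\rangle:\mathbf x\in V\}$ is similar to $P$, and $L$ vanishes on the orthogonal complement. With eigenvalues ordered decreasingly with multiplicity, $\gamma(L)=1-\lambda_2(L)$, where $\lambda_1(L)=1$. Here $|\psi\rangle=|\Psi\rangle$. *)

theory Defs
  imports
    Complex_Main
    "HOL-Library.Nat_Bijection"
    "HOL-Library.Disjoint_Sets"
    "Jordan_Normal_Form.Spectral_Radius"
    "Jordan_Normal_Form.DL_Submatrix"
begin

text \<open>
  The modes are \<open>0, \<dots>, d - 1\<close>.  A bit string indexed by a set \<open>A\<close> of modes is represented by the
  set of its occupied modes, i.e. by an element of \<open>Pow A\<close>; disjoint bit strings are concatenated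
  by union, and the restriction of \<open>x\<close> to \<open>A\<close> is \<open>x \<inter> A\<close>.  A state of the modes in \<open>A\<close> is given by
  its amplitudes in the computational basis, a function on \<open>Pow A\<close> (values elsewhere are
  irrelevant).  In a \<open>2 ^ d\<close>-dimensional matrix the index \<open>i\<close> belongs to the basis state
  \<open>set_decode i\<close>, the set of positions of the binary digits 1 of \<open>i\<close>.
\<close>

type_synonym bits = "nat set"
type_synonym amplitudes = "bits \<Rightarrow> complex"

definition hamming :: "bits \<Rightarrow> bits \<Rightarrow> nat" where
  "hamming x y = card (sym_diff x y)"

definition operator_matrix :: "nat \<Rightarrow> (bits \<Rightarrow> bits \<Rightarrow> 'a) \<Rightarrow> 'a mat" where
  "operator_matrix d f = mat (2 ^ d) (2 ^ d) (\<lambda>(i, j). f (set_decode i) (set_decode j))"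


subsection \<open>The certification walk\<close>

definition basis_prob :: "amplitudes \<Rightarrow> bits \<Rightarrow> real" where
  "basis_prob \<psi> x = (cmod (\<psi> x))\<^sup>2"

definition walk_states :: "nat \<Rightarrow> amplitudes \<Rightarrow> bits set" where
  "walk_states d \<psi> = {x \<in> Pow {..<d}. basis_prob \<psi> x > 0}"

definition walk_edges :: "nat \<Rightarrow> amplitudes \<Rightarrow> (bits \<times> bits) set" where
  "walk_edges d \<psi> = {(x, y) \<in> walk_states d \<psi> \<times> walk_states d \<psi>. hamming x y = 2}"

definition walk_entry :: "nat \<Rightarrow> amplitudes \<Rightarrow> bits \<Rightarrow> bits \<Rightarrow> real" where
  "walk_entry d \<psi> x y =
    (if (x, y) \<in> walk_edges d \<psi> then
       inverse (real (d choose 2)) * (basis_prob \<psi> y / (basis_prob \<psi> x + basis_prob \<psi> y))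
     else if x = y then
       inverse (real (d choose 2)) *
         (\<Sum>x' \<in> {x' \<in> Pow {..<d}. hamming x x' = 2}.
            basis_prob \<psi> x / (basis_prob \<psi> x + basis_prob \<psi> x'))
     else 0)"

text \<open>The chain lives on \<^term>\<open>walk_states d \<psi>\<close> only, so rows and columns are restricted to the
  indices of its elements.\<close>

definition walk_matrix :: "nat \<Rightarrow> amplitudes \<Rightarrow> real mat" where
  "walk_matrix d \<psi> =
    (let I = {i. set_decode i \<in> walk_states d \<psi>}
     in submatrix (operator_matrix d (walk_entry d \<psi>)) I I)"


subsection \<open>The operator \<open>L\<close> and its spectral gap\<close>

definition branch_prob :: "amplitudes \<Rightarrow> bits \<Rightarrow> bits \<Rightarrow> real" where
  "branch_prob \<psi> k z = (\<Sum>a \<in> Pow k. (cmod (\<psi> (z \<union> a)))\<^sup>2)"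

definition conditional_state :: "amplitudes \<Rightarrow> bits \<Rightarrow> bits \<Rightarrow> amplitudes" where
  "conditional_state \<psi> k z a = \<psi> (z \<union> a) / complex_of_real (sqrt (branch_prob \<psi> k z))"

text \<open>The summand for \<open>k\<close> and \<open>z\<close> is the \<open>(x, y)\<close> entry of the tensor product of the projector onto
  \<open>z\<close> (on the modes outside \<open>k\<close>) and the projector onto the conditional state (on \<open>k\<close>).\<close>

definition L_entry :: "nat \<Rightarrow> amplitudes \<Rightarrow> bits \<Rightarrow> bits \<Rightarrow> complex" where
  "L_entry d \<psi> x y =
    inverse (of_nat (d choose 2)) *
    (\<Sum>k \<in> {k. k \<subseteq> {..<d} \<and> card k = 2}.
     \<Sum>z \<in> {z \<in> Pow ({..<d} - k). branch_prob \<psi> k z > 0}.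
       (of_bool (x - k = z) * of_bool (y - k = z)) *
       (conditional_state \<psi> k z (x \<inter> k) * cnj (conditional_state \<psi> k z (y \<inter> k))))"

definition L_matrix :: "nat \<Rightarrow> amplitudes \<Rightarrow> complex mat" where
  "L_matrix d \<psi> = operator_matrix d (L_entry d \<psi>)"

text \<open>Meant for Hermitian matrices: all eigenvalues are real, and \<^term>\<open>Re\<close> is merely the
  coercion to the ordered type.\<close>

definition eigenvalues_decreasing :: "complex mat \<Rightarrow> real list" where
  "eigenvalues_decreasing A =
    rev (sorted_list_of_multiset (image_mset Re (proots (char_poly A))))"

text \<open>List positions start at 0, so position 1 holds the second largest eigenvalue.\<close>

definition spectral_gap :: "complex mat \<Rightarrow> real" where
  "spectral_gap A = 1 - eigenvalues_decreasing A ! 1"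


subsection \<open>Products of pair states and a number state\<close>

text \<open>States of the ordered pair of modes \<open>(a, b)\<close>: \<open>\<alpha> |10\<rangle> + \<beta> |01\<rangle>\<close> and \<open>\<alpha> |00\<rangle> + \<beta> |11\<rangle>\<close>.\<close>

definition odd_pair_state :: "nat \<Rightarrow> nat \<Rightarrow> complex \<Rightarrow> complex \<Rightarrow> amplitudes" where
  "odd_pair_state a b \<alpha> \<beta> S = (if S = {a} then \<alpha> else if S = {b} then \<beta> else 0)"

definition even_pair_state :: "nat \<Rightarrow> nat \<Rightarrow> complex \<Rightarrow> complex \<Rightarrow> amplitudes" where
  "even_pair_state a b \<alpha> \<beta> S = (if S = {} then \<alpha> else if S = {a, b} then \<beta> else 0)"

definition pairs_product_state ::
  "nat \<Rightarrow> (nat \<Rightarrow> bits) \<Rightarrow> (nat \<Rightarrow> amplitudes) \<Rightarrow> bits \<Rightarrow> amplitudes" where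
  "pairs_product_state m q \<chi> x S =
    (\<Prod>r \<in> {1..m}. \<chi> r (S \<inter> q r)) * of_bool (S - (\<Union>r \<in> {1..m}. q r) = x)"

end

theory Submission
  imports Defs
begin

text \<open>
  The states of the walk are indexed by the set \<open>S\<close> of flipped pairs, and two of them are at Hamming
  distance two exactly if they differ in one pair.  By the product form of the probabilities, the
  acceptance ratio of such a move depends on that pair only, so the walk is
  \<open>1 - 1/c \<Sum>\<^sub>r (1 - \<Pi>\<^sub>r)\<close>, where \<open>\<Pi>\<^sub>r\<close> resamples pair \<open>r\<close> from its own distribution.  The \<open>\<Pi>\<^sub>r\<close> are
  commuting projections acting on different tensor factors, and products of their eigenvectors
  diagonalize the walk.  Since the state has definite parity, \<open>L\<close> is the walk conjugated by the
  diagonal matrix of amplitudes, extended by zero; the extra eigenvalues \<open>0\<close> do not exceed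
  \<open>1 - 1/c\<close>.
\<close>

subsection \<open>Diagonalizable kernels on finite sets\<close>

text \<open>The columns of \<open>G\<close> are eigenvectors, labelled by the points of \<open>X\<close> themselves; \<open>H\<close> is the inverse
  of \<open>G\<close>.\<close>

definition diagonalizable_on ::
    "'a set \<Rightarrow> ('a \<Rightarrow> 'a \<Rightarrow> 'b::comm_ring_1) \<Rightarrow> ('a \<Rightarrow> 'b) \<Rightarrow> bool" where
  "diagonalizable_on X F l \<longleftrightarrow>
     (\<exists>G H. (\<forall>x\<in>X. \<forall>s\<in>X. (\<Sum>y\<in>X. F x y * G y s) = l s * G x s) \<and>
            (\<forall>x\<in>X. \<forall>y\<in>X. (\<Sum>s\<in>X. G x s * H s y) = of_bool (x = y)))"

lemma diagonalizable_onI: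
  assumes "\<And>x s. x \<in> X \<Longrightarrow> s \<in> X \<Longrightarrow> (\<Sum>y\<in>X. F x y * G y s) = l s * G x s"
    and "\<And>x y. x \<in> X \<Longrightarrow> y \<in> X \<Longrightarrow> (\<Sum>s\<in>X. G x s * H s y) = of_bool (x = y)"
  shows "diagonalizable_on X F l"
  unfolding diagonalizable_on_def using assms by blast

lemma diagonalizable_onE:
  assumes "diagonalizable_on X F l"
  obtains G H where "\<And>x s. x \<in> X \<Longrightarrow> s \<in> X \<Longrightarrow> (\<Sum>y\<in>X. F x y * G y s) = l s * G x s"
    and "\<And>x y. x \<in> X \<Longrightarrow> y \<in> X \<Longrightarrow> (\<Sum>s\<in>X. G x s * H s y) = of_bool (x = y)"
  using assms unfolding diagonalizable_on_def by blast

lemma diagonalizable_on_cong: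
  assumes "\<And>x y. x \<in> X \<Longrightarrow> y \<in> X \<Longrightarrow> F x y = F' x y"
  shows "diagonalizable_on X F l \<longleftrightarrow> diagonalizable_on X F' l"
  unfolding diagonalizable_on_def using assms by (simp cong: sum.cong)

text \<open>Eigenvectors and their inverse are transported along the inverse of \<open>c\<close>.
  This allows the walk to be diagonalized on subsets of pairs instead of bit strings.\<close>

lemma diagonalizable_on_reindex:
  assumes c: "bij_betw c Y X"
    and diag: "diagonalizable_on Y (\<lambda>s t. F (c s) (c t)) (\<lambda>s. l (c s))"
  shows "diagonalizable_on X F l"
proof -
  obtain G H where
    G: "\<And>x s. x \<in> Y \<Longrightarrow> s \<in> Y \<Longrightarrow> (\<Sum>y\<in>Y. F (c x) (c y) * G y s) = l (c s) * G x s" and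
    H: "\<And>x y. x \<in> Y \<Longrightarrow> y \<in> Y \<Longrightarrow> (\<Sum>s\<in>Y. G x s * H s y) = of_bool (x = y)"
    using diag by (elim diagonalizable_onE) blast
  define g where "g = inv_into Y c"
  have g: "g (c y) = y" if "y \<in> Y" for y
    using c that unfolding g_def bij_betw_def by simp
  have X: "X = c ` Y" and inj: "inj_on c Y"
    using c by (simp_all add: bij_betw_def)
  show ?thesis
  proof (rule diagonalizable_onI[of X F "\<lambda>x s. G (g x) (g s)" l "\<lambda>s x. H (g s) (g x)"])
    fix x s assume "x \<in> X" "s \<in> X"
    then show "(\<Sum>y\<in>X. F x y * G (g y) (g s)) = l s * G (g x) (g s)"
      unfolding X by (auto simp: sum.reindex[OF inj] g G)
  next
    fix x y assume "x \<in> X" "y \<in> X"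
    then show "(\<Sum>s\<in>X. G (g x) (g s) * H (g s) (g y)) = of_bool (x = y)"
      unfolding X using inj by (auto simp: sum.reindex[OF inj] g H inj_on_eq_iff)
  qed
qed

text \<open>Conjugation by the diagonal matrix of the \<open>p x\<close>: the rows of
  \<open>G\<close> are multiplied by \<open>p x\<close>, the columns of \<open>H\<close> divided by
  it, and the eigenvalues stay. The intended \<open>p\<close> is the amplitude function.\<close>

lemma diagonalizable_on_similar:
  fixes F :: "'a \<Rightarrow> 'a \<Rightarrow> 'b::field"
  assumes "diagonalizable_on X F l" and nz: "\<And>x. x \<in> X \<Longrightarrow> p x \<noteq> 0"
  shows "diagonalizable_on X (\<lambda>x y. p x * F x y / p y) l"
proof -
  obtain G H where
    G: "\<And>x s. x \<in> X \<Longrightarrow> s \<in> X \<Longrightarrow> (\<Sum>y\<in>X. F x y * G y s) = l s * G x s" and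
    H: "\<And>x y. x \<in> X \<Longrightarrow> y \<in> X \<Longrightarrow> (\<Sum>s\<in>X. G x s * H s y) = of_bool (x = y)"
    using assms(1) by (elim diagonalizable_onE) blast
  show ?thesis
  proof (rule diagonalizable_onI[of X _ "\<lambda>x s. p x * G x s" l "\<lambda>s x. H s x / p x"])
    fix x s assume x: "x \<in> X" and s: "s \<in> X"
    have "(\<Sum>y\<in>X. p x * F x y / p y * (p y * G y s)) = (\<Sum>y\<in>X. p x * (F x y * G y s))"
      by (rule sum.cong) (auto simp: nz)
    also have "\<dots> = p x * (\<Sum>y\<in>X. F x y * G y s)"
      by (rule sum_distrib_left[symmetric])
    finally show "(\<Sum>y\<in>X. p x * F x y / p y * (p y * G y s)) = l s * (p x * G x s)"
      by (simp add: G[OF x s])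
  next
    fix x y assume x: "x \<in> X" and y: "y \<in> X"
    have "(\<Sum>s\<in>X. p x * G x s * (H s y / p y)) = p x / p y * (\<Sum>s\<in>X. G x s * H s y)"
      by (simp add: sum_distrib_left mult_ac)
    then show "(\<Sum>s\<in>X. p x * G x s * (H s y / p y)) = of_bool (x = y)"
      using nz[OF y] by (simp add: H[OF x y])
  qed
qed

text \<open>A zero block is added to the kernel. Every new point contributes its own basis vector,
  with eigenvalue \<open>0\<close>.\<close>

lemma diagonalizable_on_extend:
  assumes diag: "diagonalizable_on V F l" and fin: "finite X" and sub: "V \<subseteq> X"
  shows "diagonalizable_on X (\<lambda>x y. if x \<in> V \<and> y \<in> V then F x y else 0)
           (\<lambda>x. if x \<in> V then l x else 0)"
    (is "diagonalizable_on X ?F ?l")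
proof -
  obtain G H where
    G: "\<And>x s. x \<in> V \<Longrightarrow> s \<in> V \<Longrightarrow> (\<Sum>y\<in>V. F x y * G y s) = l s * G x s" and
    H: "\<And>x y. x \<in> V \<Longrightarrow> y \<in> V \<Longrightarrow> (\<Sum>s\<in>V. G x s * H s y) = of_bool (x = y)"
    using diag by (elim diagonalizable_onE) blast
  \<comment> \<open>Both \<open>G\<close> and \<open>H\<close> are padded by an identity block
    outside \<open>V\<close>, which keeps them inverse to each other.\<close>
  define ext :: "('a \<Rightarrow> 'a \<Rightarrow> 'b) \<Rightarrow> 'a \<Rightarrow> 'a \<Rightarrow> 'b" where
    "ext g x y = (if x \<in> V \<and> y \<in> V then g x y else of_bool (x = y))" for g x y
  show ?thesis
  proof (rule diagonalizable_onI[of X ?F "ext G" ?l "ext H"])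
    fix x s assume x: "x \<in> X" and s: "s \<in> X"
    have "(\<Sum>y\<in>X. ?F x y * ext G y s) = (\<Sum>y\<in>V. ?F x y * ext G y s)"
      by (rule sum.mono_neutral_right) (use fin sub in auto)
    also have "\<dots> = ?l s * ext G x s"
    proof (cases "x \<in> V \<and> s \<in> V")
      case True
      then have "(\<Sum>y\<in>V. ?F x y * ext G y s) = (\<Sum>y\<in>V. F x y * G y s)"
        by (intro sum.cong) (auto simp: ext_def)
      then show ?thesis using True G by (simp add: ext_def)
    next
      case False
      then have "(\<Sum>y\<in>V. ?F x y * ext G y s) = 0"
        by (intro sum.neutral) (auto simp: ext_def)
      then show ?thesis using False by (auto simp: ext_def)
    qed
    finally show "(\<Sum>y\<in>X. ?F x y * ext G y s) = ?l s * ext G x s" .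
  next
    fix x y assume x: "x \<in> X" and y: "y \<in> X"
    show "(\<Sum>s\<in>X. ext G x s * ext H s y) = of_bool (x = y)"
    proof (cases "x \<in> V")
      case True
      have "(\<Sum>s\<in>X. ext G x s * ext H s y) = (\<Sum>s\<in>V. ext G x s * ext H s y)"
        by (rule sum.mono_neutral_right) (use fin sub True in \<open>auto simp: ext_def\<close>)
      also have "\<dots> = of_bool (x = y)"
      proof (cases "y \<in> V")
        case y: True
        have "(\<Sum>s\<in>V. ext G x s * ext H s y) = (\<Sum>s\<in>V. G x s * H s y)"
          by (intro sum.cong) (auto simp: ext_def True y)
        then show ?thesis using True y H by simp
      next
        case False
        then have "(\<Sum>s\<in>V. ext G x s * ext H s y) = 0"
          by (intro sum.neutral) (auto simp: ext_def)
        then show ?thesis using True False by auto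
      qed
      finally show ?thesis .
    next
      case False
      have "(\<Sum>s\<in>X. ext G x s * ext H s y) = (\<Sum>s\<in>{x}. ext G x s * ext H s y)"
        by (rule sum.mono_neutral_right) (use fin x False in \<open>auto simp: ext_def\<close>)
      then show ?thesis using False by (simp add: ext_def)
    qed
  qed
qed

lemma diagonalizable_on_of_real:
  assumes "diagonalizable_on X F l"
  shows "diagonalizable_on X (\<lambda>x y. complex_of_real (F x y)) (\<lambda>x. complex_of_real (l x))"
proof -
  obtain G H where
    G: "\<And>x s. x \<in> X \<Longrightarrow> s \<in> X \<Longrightarrow> (\<Sum>y\<in>X. F x y * G y s) = l s * G x s" and
    H: "\<And>x y. x \<in> X \<Longrightarrow> y \<in> X \<Longrightarrow> (\<Sum>s\<in>X. G x s * H s y) = of_bool (x = y)"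
    using assms by (elim diagonalizable_onE) blast
  show ?thesis
    by (rule diagonalizable_onI[of X _ "\<lambda>x s. complex_of_real (G x s)" _
          "\<lambda>s x. complex_of_real (H s x)"])
       (simp_all add: G H flip: of_real_mult of_real_sum)
qed

section \<open>Characteristic polynomials and root multiplicities\<close>

text \<open>The enumeration \<open>e\<close> turns \<open>F\<close>, \<open>G\<close>,
  \<open>H\<close> into matrices \<open>P\<close>, \<open>Q\<close>, \<open>R\<close> with
  \<open>P = Q * D * R\<close> and \<open>R\<close> inverse to \<open>Q\<close>. So \<open>P\<close>
  is similar to the diagonal matrix \<open>D\<close>. Any enumeration gives the same
  polynomial.\<close>

lemma char_poly_diagonalizable_on:
  fixes F :: "'a \<Rightarrow> 'a \<Rightarrow> 'b::field"
  assumes e: "bij_betw e {..<n} X" and diag: "diagonalizable_on X F l"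
  shows "char_poly (mat n n (\<lambda>(i, j). F (e i) (e j))) = (\<Prod>x\<in>X. [:- l x, 1:])"
proof -
  obtain G H where
    G: "\<And>x s. x \<in> X \<Longrightarrow> s \<in> X \<Longrightarrow> (\<Sum>y\<in>X. F x y * G y s) = l s * G x s" and
    H: "\<And>x y. x \<in> X \<Longrightarrow> y \<in> X \<Longrightarrow> (\<Sum>s\<in>X. G x s * H s y) = of_bool (x = y)"
    using diag by (elim diagonalizable_onE) blast
  have e': "bij_betw e {0..<n} X" using e by (simp add: lessThan_atLeast0)
  have eX: "e i \<in> X" if "i < n" for i using e that by (auto simp: bij_betw_def)
  have e_eq: "e i = e j \<longleftrightarrow> i = j" if "i < n" "j < n" for i j
    using e that by (auto simp: bij_betw_def inj_on_eq_iff)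
  define P where "P = mat n n (\<lambda>(i, j). F (e i) (e j))"
  define Q where "Q = mat n n (\<lambda>(i, j). G (e i) (e j))"
  define R where "R = mat n n (\<lambda>(i, j). H (e i) (e j))"
  define D where "D = mat n n (\<lambda>(i, j). if i = j then l (e i) else 0)"
  have [simp]: "P \<in> carrier_mat n n" "Q \<in> carrier_mat n n" "R \<in> carrier_mat n n" "D \<in> carrier_mat n n"
    by (simp_all add: P_def Q_def R_def D_def)
  have PQ: "P * Q = Q * D"
  proof (rule eq_matI)
    fix i j assume "i < dim_row (Q * D)" "j < dim_col (Q * D)"
    then have i: "i < n" and j: "j < n" by (simp_all add: Q_def D_def)
    have "(P * Q) $$ (i, j) = (\<Sum>k = 0..<n. F (e i) (e k) * G (e k) (e j))"
      using i j by (simp add: P_def Q_def scalar_prod_def)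
    also have "\<dots> = (\<Sum>y\<in>X. F (e i) y * G y (e j))"
      by (rule sum.reindex_bij_betw[OF e'])
    also have "\<dots> = l (e j) * G (e i) (e j)" by (rule G) (simp_all add: eX i j)
    also have "\<dots> = (\<Sum>k = 0..<n. if k = j then G (e i) (e k) * l (e k) else 0)"
      using j by simp
    also have "\<dots> = (Q * D) $$ (i, j)"
      using i j by (simp add: D_def Q_def scalar_prod_def if_distrib[of "(*) _"] cong: if_cong)
    finally show "(P * Q) $$ (i, j) = (Q * D) $$ (i, j)" .
  qed (simp_all add: P_def Q_def D_def)
  have QR: "Q * R = 1\<^sub>m n"
  proof (rule eq_matI)
    fix i j assume "i < dim_row (1\<^sub>m n :: 'b mat)" "j < dim_col (1\<^sub>m n :: 'b mat)"
    then have i: "i < n" and j: "j < n" by simp_all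
    have "(Q * R) $$ (i, j) = (\<Sum>k = 0..<n. G (e i) (e k) * H (e k) (e j))"
      using i j by (simp add: R_def Q_def scalar_prod_def)
    also have "\<dots> = (\<Sum>y\<in>X. G (e i) y * H y (e j))"
      by (rule sum.reindex_bij_betw[OF e'])
    also have "\<dots> = of_bool (e i = e j)" by (rule H) (simp_all add: eX i j)
    finally show "(Q * R) $$ (i, j) = 1\<^sub>m n $$ (i, j)"
      using i j e_eq by simp
  qed (simp_all add: R_def Q_def)
  \<comment> \<open>Similarity asks for a two-sided inverse; for square matrices the one-sided one
    suffices.\<close>
  have RQ: "R * Q = 1\<^sub>m n" by (rule mat_mult_left_right_inverse[OF _ _ QR]) simp_all
  have "P = P * (Q * R)" by (simp add: QR right_mult_one_mat[of P n n])
  also have "\<dots> = P * Q * R" by (rule assoc_mult_mat[symmetric, of _ n n _ n _ n]) simp_all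
  finally have PQDR: "P = Q * D * R" by (simp add: PQ)
  have "{P, D, Q, R} \<subseteq> carrier_mat n n" by simp
  then have "similar_mat P D" using QR RQ PQDR by (rule similar_matI)
  then have "char_poly P = char_poly D" by (rule char_poly_similar)
  also have "\<dots> = (\<Prod>a\<leftarrow>diag_mat D. [:- a, 1:])"
    by (rule char_poly_upper_triangular[of _ n]) (auto simp: D_def upper_triangular_def)
  also have "diag_mat D = map (\<lambda>i. l (e i)) [0..<n]"
    by (simp add: diag_mat_def D_def)
  also have "(\<Prod>a\<leftarrow>map (\<lambda>i. l (e i)) [0..<n]. [:- a, 1:]) = (\<Prod>i = 0..<n. [:- l (e i), 1:])"
    using prod.distinct_set_conv_list[of "[0..<n]" "\<lambda>i. [:- l (e i), 1:]"] by (simp add: o_def)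
  also have "\<dots> = (\<Prod>x\<in>X. [:- l x, 1:])"
    by (rule prod.reindex_bij_betw[OF e'])
  finally show ?thesis by (simp only: P_def)
qed

lemma proots_prod_linear: "proots (\<Prod>x\<in>X. [:- l x, 1:]) = image_mset l (mset_set X)"
\<comment> \<open>For infinite \<open>X\<close> the product defaults to \<open>1\<close> and
  \<open>mset_set X\<close> to the empty multiset, so both sides are empty.\<close>
proof (induction X rule: infinite_finite_induct)
  case (insert x X)
  then show ?case
    by (subst prod.insert) (simp_all add: proots_mult prod_zero_iff del: mult_pCons_left)
qed auto

text \<open>The order of a root is its count in \<open>proots\<close>, and a count in an image
  multiset is the size of a fibre of \<open>l\<close>.\<close>

lemma order_prod_linear:
  assumes "finite X"
  shows "order c (\<Prod>x\<in>X. [:- l x, 1:]) = card {x \<in> X. l x = c}"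
proof -
  have "(\<Prod>x\<in>X. [:- l x, 1:]) \<noteq> 0" using assms by (simp add: prod_zero_iff)
  then have "order c (\<Prod>x\<in>X. [:- l x, 1:]) = count (image_mset l (mset_set X)) c"
    by (simp flip: proots_prod_linear)
  also have "\<dots> = card {x \<in> X. l x = c}"
    using assms by (simp add: count_image_mset sum.If_cases vimage_def Int_def conj_commute)
  finally show ?thesis .
qed

section \<open>Matrix indices and bit strings\<close>

text \<open>\<open>set_encode\<close> inverts \<open>set_decode\<close>, which gives injectivity.
  The image lies in \<open>Pow {..<d}\<close>, by induction on the number of digits, and fills it
  because both sets have \<open>2 ^ d\<close> elements.\<close>

lemma bij_betw_set_decode: "bij_betw set_decode {..<2 ^ d} (Pow {..<d})"
proof -
  have inj: "inj_on set_decode {..<2 ^ d}"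
    by (metis inj_onI set_decode_inverse)
  have "set_decode n \<subseteq> {..<d}" if "n < 2 ^ d" for n
    using that
  proof (induction d arbitrary: n)
    case (Suc d)
    have "set_decode (n div 2) \<subseteq> {..<d}" using Suc by auto
    then show ?case
      by (auto simp: subset_iff less_Suc_eq_0_disj) (metis set_decode_Suc not0_implies_Suc)
  qed simp
  then have "set_decode ` {..<2 ^ d} \<subseteq> Pow {..<d}" by auto
  moreover have "card (set_decode ` {..<2 ^ d}) = card (Pow {..<d})"
    by (simp add: card_image[OF inj] card_Pow)
  ultimately have "set_decode ` {..<2 ^ d} = Pow {..<d}"
    by (intro card_subset_eq) auto
  with inj show ?thesis by (simp add: bij_betw_def)
qed

text \<open>\<open>pick I\<close> lists \<open>I\<close> in increasing order, starting from position
  0; it is the enumeration by which \<open>submatrix\<close> selects rows and columns.\<close>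

lemma bij_betw_pick:
  assumes "finite I"
  shows "bij_betw (pick I) {..<card I} I"
proof -
  have inj: "inj_on (pick I) {..<card I}"
    by (rule inj_onI) (metis lessThan_iff nat_neq_iff pick_mono_le)
  have "pick I ` {..<card I} \<subseteq> I" using pick_in_set_le by auto
  then have "pick I ` {..<card I} = I"
    using assms by (intro card_subset_eq) (simp_all add: card_image[OF inj])
  with inj show ?thesis by (simp add: bij_betw_def)
qed

lemma walk_states_subset: "walk_states d \<psi> \<subseteq> Pow {..<d}"
  by (auto simp: walk_states_def)

text \<open>Brings the submatrix into the form to which \<open>char_poly_diagonalizable_on\<close>
  applies: \<open>e\<close> picks an index from \<open>I\<close> and decodes it.\<close>

lemma walk_matrix_eq_mat:
  obtains e where "bij_betw e {..<card (walk_states d \<psi>)} (walk_states d \<psi>)"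
    and "walk_matrix d \<psi> = mat (card (walk_states d \<psi>)) (card (walk_states d \<psi>))
           (\<lambda>(i, j). walk_entry d \<psi> (e i) (e j))"
proof -
  define I where "I = {i. set_decode i \<in> walk_states d \<psi>}"
  have ltI: "i < 2 ^ d" if "i \<in> I" for i
  proof -
    from that have "set_decode i \<in> Pow {..<d}" by (auto simp: I_def walk_states_def)
    then obtain j where "j < 2 ^ d" "set_decode j = set_decode i"
      using bij_betw_set_decode[of d] by (metis bij_betw_iff_bijections lessThan_iff)
    then show ?thesis by (metis set_decode_inverse)
  qed
  have dec: "bij_betw set_decode I (walk_states d \<psi>)"
  proof (rule bij_betw_subset[OF bij_betw_set_decode])
    show "I \<subseteq> {..<2 ^ d}" using ltI by auto
    have "x \<in> set_decode ` I" if "x \<in> walk_states d \<psi>" for x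
    proof
      have "finite x" using that walk_states_subset[of d \<psi>] by (auto intro: finite_subset)
      then show "x = set_decode (set_encode x)" by simp
      with that show "set_encode x \<in> I" by (simp add: I_def)
    qed
    then show "set_decode ` I = walk_states d \<psi>" by (auto simp: I_def)
  qed
  have finV: "finite (walk_states d \<psi>)"
    using walk_states_subset by (rule finite_subset) simp
  have finI: "finite I" using dec finV by (simp add: bij_betw_finite)
  have cardI: "card I = card (walk_states d \<psi>)" using dec by (rule bij_betw_same_card)
  \<comment> \<open>The dimension of a submatrix counts only the selected indices inside the big
    matrix; here these are all of \<open>I\<close>.\<close>
  have I: "{i. i < 2 ^ d \<and> i \<in> I} = I" using ltI by auto
  define e where "e = set_decode \<circ> pick I"
  have "bij_betw e {..<card I} (walk_states d \<psi>)"
    unfolding e_def by (rule bij_betw_trans[OF bij_betw_pick[OF finI] dec])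
  moreover have "walk_matrix d \<psi> = mat (card I) (card I) (\<lambda>(i, j). walk_entry d \<psi> (e i) (e j))"
    unfolding walk_matrix_def Let_def I_def[symmetric] submatrix_def
    using pick_in_set_le[of _ I] ltI
    by (intro eq_matI) (simp_all add: operator_matrix_def I e_def)
  ultimately show ?thesis using that by (simp add: cardI)
qed

subsection \<open>The operator \<open>L\<close> as a conjugate of the walk\<close>

lemma basis_prob_nonneg: "basis_prob \<psi> x \<ge> 0"
  by (simp add: basis_prob_def)

lemma hamming_sym_diff: "hamming x (sym_diff x k) = card k"
proof -
  have "sym_diff x (sym_diff x k) = k" by auto
  then show ?thesis by (simp add: hamming_def)
qed

text \<open>The branch contains four basis states, namely \<open>x\<close> with a subset of
  \<open>k\<close> flipped. Flipping a single mode breaks the parity, so those two states have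
  probability zero and only \<open>x\<close> and its double flip remain.\<close>

lemma branch_prob_eq:
  assumes x: "x \<in> walk_states d \<psi>" and k: "k \<subseteq> {..<d}" "card k = 2"
    and parity: "\<And>x y. x \<in> walk_states d \<psi> \<Longrightarrow> y \<in> walk_states d \<psi> \<Longrightarrow> even (hamming x y)"
  shows "branch_prob \<psi> k (x - k) = basis_prob \<psi> x + basis_prob \<psi> (sym_diff x k)"
proof -
  obtain i j where ij: "k = {i, j}" "i \<noteq> j" using k(2) by (auto simp: card_2_iff)
  have "branch_prob \<psi> k (x - k) = (\<Sum>c\<in>Pow k. basis_prob \<psi> (sym_diff x c))"
    unfolding branch_prob_def basis_prob_def
  \<comment> \<open>The content of \<open>k\<close> is traded for the set of modes in which it
    differs from \<open>x\<close>; this substitution is an involution of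
    \<open>Pow k\<close>.\<close>
  proof (rule sum.reindex_bij_witness[of _ "\<lambda>c. sym_diff (x \<inter> k) c" "\<lambda>c. sym_diff (x \<inter> k) c"])
    fix c assume "c \<in> Pow k"
    then have "(x - k) \<union> c = sym_diff x (sym_diff (x \<inter> k) c)" by auto
    then show "(cmod (\<psi> (sym_diff x (sym_diff (x \<inter> k) c))))\<^sup>2 = (cmod (\<psi> (x - k \<union> c)))\<^sup>2"
      by simp
  qed auto
  also have "\<dots> = (\<Sum>c\<in>{{}, k}. basis_prob \<psi> (sym_diff x c))"
  proof (rule sum.mono_neutral_right)
    show "\<forall>c\<in>Pow k - {{}, k}. basis_prob \<psi> (sym_diff x c) = 0"
    proof
      fix c assume c: "c \<in> Pow k - {{}, k}"
      then have "c = {i} \<or> c = {j}" using ij by auto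
      then have "odd (hamming x (sym_diff x c))" by (auto simp only: hamming_sym_diff) simp_all
      then have "sym_diff x c \<notin> walk_states d \<psi>" using parity x by blast
      moreover have "sym_diff x c \<in> Pow {..<d}"
        using x k(1) c walk_states_subset[of d \<psi>] by auto
      ultimately show "basis_prob \<psi> (sym_diff x c) = 0"
        using basis_prob_nonneg[of \<psi> "sym_diff x c"] by (auto simp: walk_states_def)
    qed
  qed (use ij in auto)
  also have "\<dots> = basis_prob \<psi> x + basis_prob \<psi> (sym_diff x k)"
    using ij by (subst sum.insert) auto
  finally show ?thesis .
qed

text \<open>For each \<open>k\<close> only the branch \<open>z = x - k\<close> can contribute, and
  only if \<open>y\<close> lies in the same branch. The two normalizing square roots multiply to the
  branch probability.\<close>

lemma L_entry_eq_sum: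
  assumes x: "x \<in> Pow {..<d}"
  shows "L_entry d \<psi> x y = inverse (of_nat (d choose 2)) *
    (\<Sum>k\<in>{k. k \<subseteq> {..<d} \<and> card k = 2}. of_bool (x - k = y - k \<and> branch_prob \<psi> k (x - k) > 0) *
       (\<psi> x * cnj (\<psi> y) / complex_of_real (branch_prob \<psi> k (x - k))))"
proof -
  have "(\<Sum>z \<in> {z \<in> Pow ({..<d} - k). branch_prob \<psi> k z > 0}.
       (of_bool (x - k = z) * of_bool (y - k = z)) *
       (conditional_state \<psi> k z (x \<inter> k) * cnj (conditional_state \<psi> k z (y \<inter> k)))) =
     of_bool (x - k = y - k \<and> branch_prob \<psi> k (x - k) > 0) *
       (\<psi> x * cnj (\<psi> y) / complex_of_real (branch_prob \<psi> k (x - k)))" (is "?l = ?r") for k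
  proof (cases "x - k = y - k \<and> branch_prob \<psi> k (x - k) > 0")
    case True
    define b where "b = branch_prob \<psi> k (x - k)"
    have b: "b > 0" using True unfolding b_def by blast
    have x': "(x - k) \<union> (x \<inter> k) = x" and y': "(x - k) \<union> (y \<inter> k) = y"
      using True by auto
    have sq: "complex_of_real (sqrt b) * complex_of_real (sqrt b) = complex_of_real b"
      using b by (simp flip: of_real_mult)
    have "?l = (\<Sum>z \<in> {x - k}. (of_bool (x - k = z) * of_bool (y - k = z)) *
       (conditional_state \<psi> k z (x \<inter> k) * cnj (conditional_state \<psi> k z (y \<inter> k))))"
      by (rule sum.mono_neutral_right) (use x True in auto)
    also have "\<dots> =
        conditional_state \<psi> k (x - k) (x \<inter> k) * cnj (conditional_state \<psi> k (x - k) (y \<inter> k))"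
      using True by simp
    also have "\<dots> = \<psi> x / complex_of_real (sqrt b) * (cnj (\<psi> y) / complex_of_real (sqrt b))"
      unfolding conditional_state_def x' y' b_def[symmetric] by simp
    also have "\<dots> = \<psi> x * cnj (\<psi> y) / complex_of_real b"
      by (simp add: sq)
    also have "\<dots> = ?r"
    proof -
      have "of_bool (x - k = y - k \<and> branch_prob \<psi> k (x - k) > 0) = (1::complex)"
        unfolding of_bool_def by (rule if_P[OF True])
      then show ?thesis unfolding b_def by (simp only: mult_1)
    qed
    finally show ?thesis .
  next
    case False
    then have "?l = 0" by (intro sum.neutral) auto
    then show ?thesis using False by auto
  qed
  then show ?thesis by (simp add: L_entry_def)
qed

lemma finite_pairs: "finite {k. k \<subseteq> {..<d::nat} \<and> card k = 2}"
  by (rule finite_subset[of _ "Pow {..<d}"]) auto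

text \<open>Merges the cases of the walk into one sum over \<open>k\<close>, to be compared with
  \<open>L\<close> term by term. The condition \<open>x - k = y - k\<close> says that
  \<open>x\<close> and \<open>y\<close> differ only inside \<open>k\<close>: every \<open>k\<close>
  passes if \<open>x = y\<close>, exactly \<open>k = sym_diff x y\<close> passes at distance two,
  and none passes at larger distance.\<close>

lemma walk_entry_eq_sum:
  assumes x: "x \<in> walk_states d \<psi>" and y: "y \<in> walk_states d \<psi>"
    and parity: "even (hamming x y)"
  shows "walk_entry d \<psi> x y = inverse (real (d choose 2)) *
    (\<Sum>k\<in>{k. k \<subseteq> {..<d} \<and> card k = 2}. of_bool (x - k = y - k) *
       (basis_prob \<psi> y / (basis_prob \<psi> x + basis_prob \<psi> (sym_diff x k))))"
proof -
  have fin: "finite x" "finite y" and sub: "x \<subseteq> {..<d}" "y \<subseteq> {..<d}"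
    using x y walk_states_subset[of d \<psi>] by (auto intro: finite_subset)
  consider "x = y" | "x \<noteq> y" "hamming x y = 2" | "x \<noteq> y" "hamming x y \<noteq> 2" by blast
  then show ?thesis
  proof cases
    case 1
    have "(\<Sum>x' \<in> {x' \<in> Pow {..<d}. hamming x x' = 2}.
            basis_prob \<psi> x / (basis_prob \<psi> x + basis_prob \<psi> x')) =
      (\<Sum>k\<in>{k. k \<subseteq> {..<d} \<and> card k = 2}.
       basis_prob \<psi> x / (basis_prob \<psi> x + basis_prob \<psi> (sym_diff x k)))"
    \<comment> \<open>The states \<open>x'\<close> at distance two are exactly the double flips of
      \<open>x\<close>, and \<open>sym_diff x\<close> is its own inverse.\<close>
    proof (rule sum.reindex_bij_witness[of _ "sym_diff x" "sym_diff x"])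
      fix x' assume "x' \<in> {x' \<in> Pow {..<d}. hamming x x' = 2}"
      then show "sym_diff x x' \<in> {k. k \<subseteq> {..<d} \<and> card k = 2}"
        using sub by (auto simp: hamming_def)
      have *: "sym_diff x (sym_diff x x') = x'" by auto
      then show "sym_diff x (sym_diff x x') = x'" .
      show "basis_prob \<psi> x / (basis_prob \<psi> x + basis_prob \<psi> (sym_diff x (sym_diff x x'))) =
        basis_prob \<psi> x / (basis_prob \<psi> x + basis_prob \<psi> x')" by (simp only: *)
    next
      fix k assume "k \<in> {k. k \<subseteq> {..<d} \<and> card k = 2}"
      then show "sym_diff x k \<in> {x' \<in> Pow {..<d}. hamming x x' = 2}"
        using sub by (simp only: mem_Collect_eq hamming_sym_diff) auto
    qed auto
    then show ?thesis using 1 by (simp add: walk_entry_def walk_edges_def hamming_def)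
  next
    case 2
    have dd: "sym_diff x (sym_diff x y) = y" by auto
    have "(\<Sum>k\<in>{k. k \<subseteq> {..<d} \<and> card k = 2}. of_bool (x - k = y - k) *
       (basis_prob \<psi> y / (basis_prob \<psi> x + basis_prob \<psi> (sym_diff x k)))) =
      (\<Sum>k\<in>{sym_diff x y}. of_bool (x - k = y - k) *
       (basis_prob \<psi> y / (basis_prob \<psi> x + basis_prob \<psi> (sym_diff x k))))"
    proof (rule sum.mono_neutral_right[OF finite_pairs])
      show "{sym_diff x y} \<subseteq> {k. k \<subseteq> {..<d} \<and> card k = 2}"
        using sub 2 by (auto simp: hamming_def)
      show "\<forall>k\<in>{k. k \<subseteq> {..<d} \<and> card k = 2} - {sym_diff x y}. of_bool (x - k = y - k) *
       (basis_prob \<psi> y / (basis_prob \<psi> x + basis_prob \<psi> (sym_diff x k))) = 0"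
      proof
        fix k assume k: "k \<in> {k. k \<subseteq> {..<d} \<and> card k = 2} - {sym_diff x y}"
        have "x - k \<noteq> y - k"
        proof
          assume "x - k = y - k"
          then have "sym_diff x y \<subseteq> k" by auto
          moreover have "finite k" using k by (auto intro: finite_subset)
          ultimately have "sym_diff x y = k"
            using k 2 by (intro card_subset_eq) (auto simp: hamming_def)
          with k show False by simp
        qed
        then show "of_bool (x - k = y - k) *
          (basis_prob \<psi> y / (basis_prob \<psi> x + basis_prob \<psi> (sym_diff x k))) = 0" by simp
      qed
    qed
    also have "\<dots> = of_bool (x - sym_diff x y = y - sym_diff x y) *
       (basis_prob \<psi> y / (basis_prob \<psi> x + basis_prob \<psi> (sym_diff x (sym_diff x y))))"
      by simp
    also have "\<dots> = basis_prob \<psi> y / (basis_prob \<psi> x + basis_prob \<psi> y)"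
    proof -
      have "x - sym_diff x y = y - sym_diff x y" by auto
      then show ?thesis unfolding dd by simp
    qed
    finally show ?thesis using 2 x y by (simp add: walk_entry_def walk_edges_def)
  next
    case 3
    have "x - k \<noteq> y - k" if "k \<subseteq> {..<d}" "card k = 2" for k
    proof
      assume "x - k = y - k"
      then have "sym_diff x y \<subseteq> k" by auto
      moreover have "finite k" using that by (auto intro: finite_subset)
      ultimately have "hamming x y \<le> 2"
        unfolding hamming_def using that(2) by (metis card_mono)
      moreover have "hamming x y \<noteq> 0"
        using 3(1) fin by (auto simp: hamming_def)
      \<comment> \<open>Only distance one is left, and it is odd.\<close>
      ultimately show False using 3(2) parity by (cases "hamming x y = 1") auto
    qed
    then have "(\<Sum>k\<in>{k. k \<subseteq> {..<d} \<and> card k = 2}. of_bool (x - k = y - k) *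
       (basis_prob \<psi> y / (basis_prob \<psi> x + basis_prob \<psi> (sym_diff x k)))) = 0"
      by (intro sum.neutral) auto
    then show ?thesis using 3 by (simp add: walk_entry_def walk_edges_def)
  qed
qed

text \<open>On the support the sums for \<open>L\<close> and for the walk agree term by term up to
  the factor \<open>\<psi> x / \<psi> y\<close>, since \<open>\<psi> x * cnj (\<psi> y)\<close> is
  this factor times \<open>basis_prob \<psi> y\<close>. Off the support an amplitude vanishes, and
  the entry with it.\<close>

lemma L_entry_eq_walk_entry:
  assumes x: "x \<in> Pow {..<d}" and y: "y \<in> Pow {..<d}"
    and parity: "\<And>x y. x \<in> walk_states d \<psi> \<Longrightarrow> y \<in> walk_states d \<psi> \<Longrightarrow> even (hamming x y)"
  shows "L_entry d \<psi> x y =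
    (if x \<in> walk_states d \<psi> \<and> y \<in> walk_states d \<psi>
     then \<psi> x * complex_of_real (walk_entry d \<psi> x y) / \<psi> y else 0)"
proof (cases "x \<in> walk_states d \<psi> \<and> y \<in> walk_states d \<psi>")
  case True
  let ?K = "{k. k \<subseteq> {..<d} \<and> card k = 2}"
  have xV: "x \<in> walk_states d \<psi>" and yV: "y \<in> walk_states d \<psi>" using True by auto
  have pos: "basis_prob \<psi> x > 0" and nz: "\<psi> y \<noteq> 0"
    using True by (auto simp: walk_states_def basis_prob_def)
  have sq: "complex_of_real (basis_prob \<psi> y) = \<psi> y * cnj (\<psi> y)"
    unfolding basis_prob_def by (rule complex_norm_square)
  have "L_entry d \<psi> x y = inverse (of_nat (d choose 2)) *
    (\<Sum>k\<in>?K. of_bool (x - k = y - k \<and> branch_prob \<psi> k (x - k) > 0) *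
       (\<psi> x * cnj (\<psi> y) / complex_of_real (branch_prob \<psi> k (x - k))))"
    by (rule L_entry_eq_sum[OF x])
  also have "\<dots> = inverse (of_nat (d choose 2)) *
    (\<Sum>k\<in>?K. \<psi> x / \<psi> y * complex_of_real (of_bool (x - k = y - k) *
       (basis_prob \<psi> y / (basis_prob \<psi> x + basis_prob \<psi> (sym_diff x k)))))"
  proof (rule arg_cong[where f = "(*) (inverse (of_nat (d choose 2)))"], rule sum.cong[OF refl])
    fix k assume "k \<in> ?K"
    then have "branch_prob \<psi> k (x - k) = basis_prob \<psi> x + basis_prob \<psi> (sym_diff x k)"
      using True parity by (intro branch_prob_eq) auto
    moreover have "basis_prob \<psi> x + basis_prob \<psi> (sym_diff x k) > 0"
      using pos basis_prob_nonneg[of \<psi> "sym_diff x k"] by linarith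
    ultimately show "of_bool (x - k = y - k \<and> branch_prob \<psi> k (x - k) > 0) *
       (\<psi> x * cnj (\<psi> y) / complex_of_real (branch_prob \<psi> k (x - k))) =
       \<psi> x / \<psi> y * complex_of_real (of_bool (x - k = y - k) *
       (basis_prob \<psi> y / (basis_prob \<psi> x + basis_prob \<psi> (sym_diff x k))))"
      using nz by (simp add: sq)
  qed
  also have "\<dots> = \<psi> x / \<psi> y * complex_of_real (walk_entry d \<psi> x y)"
    unfolding walk_entry_eq_sum[OF xV yV parity[OF xV yV]]
      sum_distrib_left[symmetric] of_real_sum[symmetric] by simp
  finally show ?thesis using True by simp
next
  case False
  then have "\<psi> x = 0 \<or> \<psi> y = 0" using x y by (auto simp: walk_states_def basis_prob_def)
  then show ?thesis using False by (auto simp: L_entry_eq_sum[OF x])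
qed

section \<open>Roots of the characteristic polynomials of \<open>L\<close> and of the walk\<close>

text \<open>The eigenvectors of the walk pass to \<open>L\<close> by conjugation with the amplitudes
  and extension by zero.\<close>

lemma char_poly_L_matrix:
  assumes diag: "diagonalizable_on (walk_states d \<psi>) (walk_entry d \<psi>) l"
    and parity: "\<And>x y. x \<in> walk_states d \<psi> \<Longrightarrow> y \<in> walk_states d \<psi> \<Longrightarrow> even (hamming x y)"
  shows "char_poly (L_matrix d \<psi>) =
    (\<Prod>x\<in>Pow {..<d}. [:- (if x \<in> walk_states d \<psi> then complex_of_real (l x) else 0), 1:])"
proof -
  have "diagonalizable_on (walk_states d \<psi>)
      (\<lambda>x y. \<psi> x * complex_of_real (walk_entry d \<psi> x y) / \<psi> y) (\<lambda>x. complex_of_real (l x))"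
    by (intro diagonalizable_on_similar diagonalizable_on_of_real diag)
       (auto simp: walk_states_def basis_prob_def)
  then have "diagonalizable_on (Pow {..<d})
      (\<lambda>x y. if x \<in> walk_states d \<psi> \<and> y \<in> walk_states d \<psi>
        then \<psi> x * complex_of_real (walk_entry d \<psi> x y) / \<psi> y else 0)
      (\<lambda>x. if x \<in> walk_states d \<psi> then complex_of_real (l x) else 0)"
    by (rule diagonalizable_on_extend) (simp_all add: walk_states_subset)
  also have "?this \<longleftrightarrow> diagonalizable_on (Pow {..<d}) (L_entry d \<psi>)
      (\<lambda>x. if x \<in> walk_states d \<psi> then complex_of_real (l x) else 0)"
    using parity by (intro diagonalizable_on_cong L_entry_eq_walk_entry[symmetric]) auto
  finally show ?thesis
    unfolding L_matrix_def operator_matrix_def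
    by (rule char_poly_diagonalizable_on[OF bij_betw_set_decode])
qed

lemma char_poly_walk_matrix:
  assumes "diagonalizable_on (walk_states d \<psi>) (walk_entry d \<psi>) l"
  shows "char_poly (map_mat complex_of_real (walk_matrix d \<psi>)) =
    (\<Prod>x\<in>walk_states d \<psi>. [:- complex_of_real (l x), 1:])"
proof -
  define n where "n = card (walk_states d \<psi>)"
  obtain e where e: "bij_betw e {..<n} (walk_states d \<psi>)"
    and W: "walk_matrix d \<psi> = mat n n (\<lambda>(i, j). walk_entry d \<psi> (e i) (e j))"
    unfolding n_def by (rule walk_matrix_eq_mat)
  have "map_mat complex_of_real (walk_matrix d \<psi>) =
    mat n n (\<lambda>(i, j). complex_of_real (walk_entry d \<psi> (e i) (e j)))"
    by (intro eq_matI) (simp_all add: W)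
  then show ?thesis
    using char_poly_diagonalizable_on[OF e diagonalizable_on_of_real[OF assms]] by simp
qed

lemma walk_matrix_carrier:
  "walk_matrix d \<psi> \<in> carrier_mat (card (walk_states d \<psi>)) (card (walk_states d \<psi>))"
  by (rule walk_matrix_eq_mat[of d \<psi>]) simp

lemma spectrum_walk_matrix:
  assumes "diagonalizable_on (walk_states d \<psi>) (walk_entry d \<psi>) l"
  shows "spectrum (map_mat complex_of_real (walk_matrix d \<psi>)) =
    (\<lambda>x. complex_of_real (l x)) ` walk_states d \<psi>"
proof -
  have fin: "finite (walk_states d \<psi>)" using walk_states_subset by (rule finite_subset) simp
  have "map_mat complex_of_real (walk_matrix d \<psi>)
      \<in> carrier_mat (card (walk_states d \<psi>)) (card (walk_states d \<psi>))"
    using walk_matrix_carrier by simp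
  then have "spectrum (map_mat complex_of_real (walk_matrix d \<psi>)) =
      {c. poly (char_poly (map_mat complex_of_real (walk_matrix d \<psi>))) c = 0}"
    by (auto simp: spectrum_def eigenvalue_root_char_poly)
  also have "\<dots> = (\<lambda>x. complex_of_real (l x)) ` walk_states d \<psi>"
    using fin by (auto simp: char_poly_walk_matrix[OF assms] poly_prod prod_zero_iff)
  finally show ?thesis .
qed

text \<open>If \<open>u\<close> and \<open>v\<close> dominate all other roots, the increasing list
  ends with \<open>Re v, Re u\<close>, so after reversal \<open>Re v\<close> stands at position
  1.\<close>

lemma eigenvalues_decreasing_nth_1:
  assumes "proots (char_poly A) = add_mset u (add_mset v N)"
    and "Re v \<le> Re u" and "\<And>t. t \<in># N \<Longrightarrow> Re t \<le> Re v"
  shows "eigenvalues_decreasing A ! 1 = Re v"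
proof -
  define xs where "xs = sorted_list_of_multiset (image_mset Re N) @ [Re v, Re u]"
  have "sorted xs" using assms(2,3) by (force simp: xs_def sorted_append)
  moreover have "mset xs = image_mset Re (proots (char_poly A))"
    by (simp add: xs_def assms(1))
  ultimately have "sorted_list_of_multiset (image_mset Re (proots (char_poly A))) = xs"
    by (metis sorted_list_of_multiset_mset sorted_sort_id)
  then show ?thesis by (simp add: eigenvalues_decreasing_def xs_def)
qed

subsection \<open>Independent pair flips\<close>

text \<open>What remains of the state once phases and the kind of each pair are forgotten: a
  reference string \<open>base\<close>, and for each pair the probability \<open>w r True\<close> of
  being flipped relative to it and \<open>w r False\<close> of not being flipped. The assumptions
  \<open>states\<close> and \<open>prob\<close> say that the support consists of all combinations of
  flips and that flips are independent.\<close>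

locale pair_flips =
  fixes d :: nat and M :: "'i set" and q :: "'i \<Rightarrow> bits" and base :: bits
    and w :: "'i \<Rightarrow> bool \<Rightarrow> real" and \<psi> :: amplitudes
  assumes fin: "finite M"
    and q_sub: "r \<in> M \<Longrightarrow> q r \<subseteq> {..<d}"
    and q_card: "r \<in> M \<Longrightarrow> card (q r) = 2"
    and q_disj: "disjoint_family_on q M"
    and w_pos: "r \<in> M \<Longrightarrow> w r s > 0"
    and w_sum: "r \<in> M \<Longrightarrow> w r True + w r False = 1"
    and states: "walk_states d \<psi> = (\<lambda>S. sym_diff base (\<Union>r\<in>S. q r)) ` Pow M"
    and prob: "S \<subseteq> M \<Longrightarrow>
      basis_prob \<psi> (sym_diff base (\<Union>r\<in>S. q r)) = (\<Prod>r\<in>M. w r (r \<in> S))"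
begin

text \<open>Flipping both modes exchanges the two basis states of a pair in either kind of pair
  state, so one formula covers both.\<close>

definition conf :: "'i set \<Rightarrow> bits" where
  "conf S = sym_diff base (\<Union>r\<in>S. q r)"

lemma q_disjoint: "r \<in> M \<Longrightarrow> t \<in> M \<Longrightarrow> r \<noteq> t \<Longrightarrow> q r \<inter> q t = {}"
  using q_disj by (auto simp: disjoint_family_on_def)

lemma q_unique: "n \<in> q r \<Longrightarrow> n \<in> q t \<Longrightarrow> r \<in> M \<Longrightarrow> t \<in> M \<Longrightarrow> r = t"
  using q_disjoint by blast

text \<open>The reference string cancels, and disjointness of the pairs lets the union commute with
  the symmetric difference.\<close>

lemma sym_diff_conf:
  assumes "S \<subseteq> M" "T \<subseteq> M"
  shows "sym_diff (conf S) (conf T) = (\<Union>r\<in>sym_diff S T. q r)"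
proof -
  have "sym_diff (conf S) (conf T) = sym_diff (\<Union>r\<in>S. q r) (\<Union>r\<in>T. q r)"
    unfolding conf_def by blast
  also have "\<dots> = (\<Union>r\<in>sym_diff S T. q r)"
    using assms q_unique by blast
  finally show ?thesis .
qed

text \<open>Each differing pair contributes its two modes. Hence the walk graph is the hypercube of
  subsets of \<open>M\<close>, with edges between subsets that differ in one element.\<close>

lemma hamming_conf:
  assumes "S \<subseteq> M" "T \<subseteq> M"
  shows "hamming (conf S) (conf T) = 2 * card (sym_diff S T)"
proof -
  have sub: "sym_diff S T \<subseteq> M" using assms by auto
  have "card (\<Union>r\<in>sym_diff S T. q r) = (\<Sum>r\<in>sym_diff S T. card (q r))"
  proof (rule card_UN_disjoint)
    show "finite (sym_diff S T)" using sub fin by (rule finite_subset)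
    show "\<forall>r\<in>sym_diff S T. finite (q r)"
      using sub q_sub finite_subset[OF _ finite_lessThan[of d]] by blast
    show "\<forall>i\<in>sym_diff S T. \<forall>j\<in>sym_diff S T. i \<noteq> j \<longrightarrow> q i \<inter> q j = {}"
      using sub q_disjoint by blast
  qed
  also have "\<dots> = (\<Sum>r\<in>sym_diff S T. 2)"
    by (rule sum.cong) (use sub q_card in auto)
  finally show ?thesis by (simp add: hamming_def sym_diff_conf[OF assms])
qed

lemma conf_mem: "S \<subseteq> M \<Longrightarrow> conf S \<in> walk_states d \<psi>"
  unfolding states conf_def by blast

lemma bij_betw_conf: "bij_betw conf (Pow M) (walk_states d \<psi>)"
proof -
  have "S = T" if "S \<subseteq> M" "T \<subseteq> M" "conf S = conf T" for S T
  proof -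
    have "card (sym_diff S T) = 0"
      using hamming_conf[OF that(1,2)] that(3) by (simp add: hamming_def)
    moreover have "finite (sym_diff S T)"
      using that fin by (auto intro: finite_subset)
    ultimately show ?thesis by auto
  qed
  then have "inj_on conf (Pow M)" unfolding inj_on_def by blast
  moreover have "conf ` Pow M = walk_states d \<psi>" by (simp add: states conf_def)
  ultimately show ?thesis by (simp add: bij_betw_def)
qed

lemma walk_statesE:
  assumes "x \<in> walk_states d \<psi>"
  obtains S where "S \<subseteq> M" "x = conf S"
proof -
  have "x \<in> conf ` Pow M" using assms by (simp only: bij_betw_imp_surj_on[OF bij_betw_conf])
  then show ?thesis using that by (elim imageE) (simp only: Pow_iff)
qed

text \<open>Definite parity of the state, in the form that the comparison of \<open>L\<close> with
  the walk asks for.\<close>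

lemma even_hamming:
  assumes "x \<in> walk_states d \<psi>" "y \<in> walk_states d \<psi>"
  shows "even (hamming x y)"
proof -
  obtain S where S: "S \<subseteq> M" "x = conf S" using assms(1) by (rule walk_statesE)
  obtain T where T: "T \<subseteq> M" "y = conf T" using assms(2) by (rule walk_statesE)
  show ?thesis unfolding S(2) T(2) hamming_conf[OF S(1) T(1)] by simp
qed

lemma prob_conf: "S \<subseteq> M \<Longrightarrow> basis_prob \<psi> (conf S) = (\<Prod>r\<in>M. w r (r \<in> S))"
  unfolding conf_def by (rule prob)

text \<open>The factors of all other pairs form a common positive factor \<open>c\<close>, which
  cancels; the two weights of pair \<open>r\<close> add up to one.\<close>

lemma prob_ratio:
  assumes S: "S \<subseteq> M" and r: "r \<in> M"
  shows "basis_prob \<psi> (conf (sym_diff S {r})) /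
    (basis_prob \<psi> (conf S) + basis_prob \<psi> (conf (sym_diff S {r}))) = w r (r \<notin> S)"
proof -
  define c where "c = (\<Prod>t\<in>M - {r}. w t (t \<in> S))"
  have c: "c > 0" unfolding c_def by (rule prod_pos) (use w_pos in auto)
  have 1: "basis_prob \<psi> (conf S) = w r (r \<in> S) * c"
    unfolding prob_conf[OF S] c_def using fin r by (rule prod.remove)
  have S': "sym_diff S {r} \<subseteq> M" using S r by auto
  have "basis_prob \<psi> (conf (sym_diff S {r})) =
      w r (r \<in> sym_diff S {r}) * (\<Prod>t\<in>M - {r}. w t (t \<in> sym_diff S {r}))"
    unfolding prob_conf[OF S'] using fin r by (rule prod.remove)
  also have "(\<Prod>t\<in>M - {r}. w t (t \<in> sym_diff S {r})) = c"
    unfolding c_def by (rule prod.cong) auto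
  also have "(r \<in> sym_diff S {r}) = (r \<notin> S)" by auto
  finally have 2: "basis_prob \<psi> (conf (sym_diff S {r})) = w r (r \<notin> S) * c" .
  have "w r (r \<in> S) + w r (r \<notin> S) = 1" using w_sum[OF r] by (cases "r \<in> S") auto
  then have "w r (r \<in> S) * c + w r (r \<notin> S) * c = c" by (simp flip: distrib_right)
  then show ?thesis unfolding 1 2 using c by simp
qed

lemma sym_diff_q:
  assumes "S \<subseteq> M" "r \<in> M"
  shows "sym_diff (conf S) (q r) = conf (sym_diff S {r})"
proof -
  have S': "sym_diff S {r} \<subseteq> M" using assms by auto
  have "sym_diff S (sym_diff S {r}) = {r}" by auto
  then have "sym_diff (conf S) (conf (sym_diff S {r})) = q r"
    unfolding sym_diff_conf[OF assms(1) S'] by simp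
  then show ?thesis by auto
qed

lemma walk_entry_flip:
  assumes S: "S \<subseteq> M" and r: "r \<in> M"
  shows "walk_entry d \<psi> (conf S) (conf (sym_diff S {r})) =
    inverse (real (d choose 2)) * w r (r \<notin> S)"
proof -
  have S': "sym_diff S {r} \<subseteq> M" using S r by auto
  have "sym_diff S (sym_diff S {r}) = {r}" by auto
  then have "hamming (conf S) (conf (sym_diff S {r})) = 2"
    unfolding hamming_conf[OF S S'] by simp
  then have "(conf S, conf (sym_diff S {r})) \<in> walk_edges d \<psi>"
    using conf_mem[OF S] conf_mem[OF S'] by (simp add: walk_edges_def)
  then have "walk_entry d \<psi> (conf S) (conf (sym_diff S {r})) = inverse (real (d choose 2)) *
    (basis_prob \<psi> (conf (sym_diff S {r})) /
    (basis_prob \<psi> (conf S) + basis_prob \<psi> (conf (sym_diff S {r}))))"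
    by (simp only: walk_entry_def if_True)
  then show ?thesis unfolding prob_ratio[OF S r] .
qed

lemma walk_entry_far:
  assumes S: "S \<subseteq> M" and T: "T \<subseteq> M" and "T \<noteq> S" and far: "\<And>r. r \<in> M \<Longrightarrow> T \<noteq> sym_diff S {r}"
  shows "walk_entry d \<psi> (conf S) (conf T) = 0"
proof -
  have "conf S \<noteq> conf T"
    using bij_betw_imp_inj_on[OF bij_betw_conf] S T \<open>T \<noteq> S\<close> by (auto dest: inj_onD)
  moreover have "card (sym_diff S T) \<noteq> 1"
  proof
    assume "card (sym_diff S T) = 1"
    then obtain r where r: "sym_diff S T = {r}" by (auto simp: card_1_singleton_iff)
    then have "r \<in> M" "T = sym_diff S {r}" using S T by auto
    with far show False by blast
  qed
  ultimately show ?thesis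
    by (simp add: walk_entry_def walk_edges_def hamming_conf[OF S T])
qed

text \<open>Each of the \<open>d choose 2\<close> double flips contributes one minus its acceptance
  ratio \<open>f k\<close>. This ratio vanishes unless the flip stays in the support, that is,
  unless \<open>k\<close> is one of the pairs.\<close>

lemma walk_entry_diag:
  assumes S: "S \<subseteq> M" and d: "d \<ge> 2"
  shows "walk_entry d \<psi> (conf S) (conf S) =
    1 - inverse (real (d choose 2)) * (\<Sum>r\<in>M. w r (r \<notin> S))"
proof -
  let ?K = "{k. k \<subseteq> {..<d} \<and> card k = 2}"
  let ?p = "basis_prob \<psi>"
  have pos: "?p (conf S) > 0" using conf_mem[OF S] by (simp add: walk_states_def)
  have sub: "conf S \<subseteq> {..<d}" using conf_mem[OF S] walk_states_subset by blast
  define f where "f k = ?p (sym_diff (conf S) k) / (?p (conf S) + ?p (sym_diff (conf S) k))" for k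
  have inj: "inj_on q M"
  proof (rule inj_onI)
    fix r t assume "r \<in> M" "t \<in> M" "q r = q t"
    moreover have "q r \<noteq> {}" using q_card[OF \<open>r \<in> M\<close>] by auto
    ultimately show "r = t" using q_disjoint by blast
  qed
  have "walk_entry d \<psi> (conf S) (conf S) = inverse (real (d choose 2)) *
      (\<Sum>k\<in>?K. ?p (conf S) / (?p (conf S) + ?p (sym_diff (conf S) k)))"
    by (subst walk_entry_eq_sum[OF conf_mem[OF S] conf_mem[OF S]]) (simp_all add: hamming_def)
  also have "(\<Sum>k\<in>?K. ?p (conf S) / (?p (conf S) + ?p (sym_diff (conf S) k))) = (\<Sum>k\<in>?K. 1 - f k)"
  proof (rule sum.cong[OF refl])
    fix k
    have "?p (conf S) + ?p (sym_diff (conf S) k) \<noteq> 0"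
      using pos basis_prob_nonneg[of \<psi> "sym_diff (conf S) k"] by linarith
    then show "?p (conf S) / (?p (conf S) + ?p (sym_diff (conf S) k)) = 1 - f k"
      unfolding f_def by (simp add: field_simps)
  qed
  also have "\<dots> = real (card ?K) - (\<Sum>k\<in>?K. f k)" by (simp add: sum_subtractf)
  also have "card ?K = d choose 2" by (simp add: n_subsets)
  also have "(\<Sum>k\<in>?K. f k) = (\<Sum>k\<in>q ` M. f k)"
  proof (rule sum.mono_neutral_right[OF finite_pairs])
    show "q ` M \<subseteq> ?K" using q_sub q_card by blast
    show "\<forall>k\<in>?K - q ` M. f k = 0"
    proof
      fix k assume k: "k \<in> ?K - q ` M"
      \<comment> \<open>A flip that stays in the support changes a whole number of pairs; with only
        two modes in \<open>k\<close> this is one pair, and \<open>k\<close> equals it.\<close>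
      have "sym_diff (conf S) k \<notin> walk_states d \<psi>"
      proof
        assume "sym_diff (conf S) k \<in> walk_states d \<psi>"
        then obtain T where T: "T \<subseteq> M" "sym_diff (conf S) k = conf T"
          by (rule walk_statesE)
        have "2 * card (sym_diff S T) = card k"
          using hamming_sym_diff[of "conf S" k] unfolding T(2) hamming_conf[OF S T(1)] .
        then have "card (sym_diff S T) = 1" using k by simp
        then obtain r where r: "sym_diff S T = {r}" by (auto simp: card_1_singleton_iff)
        then have rM: "r \<in> M" using S T by auto
        have "k = sym_diff (conf S) (conf T)" using T(2) by auto
        then have "k = q r" unfolding sym_diff_conf[OF S T(1)] r by simp
        with k rM show False by blast
      qed
      moreover have "sym_diff (conf S) k \<in> Pow {..<d}" using k sub by auto
      ultimately have "?p (sym_diff (conf S) k) = 0"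
        using basis_prob_nonneg[of \<psi> "sym_diff (conf S) k"] by (auto simp: walk_states_def)
      then show "f k = 0" by (simp only: f_def div_0)
    qed
  qed
  also have "\<dots> = (\<Sum>r\<in>M. f (q r))" by (simp add: sum.reindex[OF inj])
  also have "\<dots> = (\<Sum>r\<in>M. w r (r \<notin> S))"
    by (rule sum.cong) (simp_all only: f_def sym_diff_q[OF S] prob_ratio[OF S])
  finally show ?thesis using d by (simp add: right_diff_distrib binomial_eq_0_iff)
qed

text \<open>The action of the walk on a function \<open>g\<close>. The \<open>r\<close>-th summand
  is \<open>g\<close> minus its average over pair \<open>r\<close>, since the weights of the pair
  sum to one: staying keeps \<open>g S\<close>, and only the flipped part survives.\<close>

lemma walk_entry_sum:
  assumes S: "S \<subseteq> M" and d: "d \<ge> 2"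
  shows "(\<Sum>T\<in>Pow M. walk_entry d \<psi> (conf S) (conf T) * g T) =
    g S - inverse (real (d choose 2)) * (\<Sum>r\<in>M. w r (r \<notin> S) * (g S - g (sym_diff S {r})))"
proof -
  let ?c = "inverse (real (d choose 2))"
  let ?h = "\<lambda>T. walk_entry d \<psi> (conf S) (conf T) * g T"
  let ?N = "(\<lambda>r. sym_diff S {r}) ` M"
  have inj: "inj_on (\<lambda>r. sym_diff S {r}) M" by (rule inj_onI) auto
  \<comment> \<open>Only \<open>S\<close> itself and its hypercube neighbours have nonzero
    entries.\<close>
  have "sum ?h (Pow M) = sum ?h (insert S ?N)"
    by (rule sum.mono_neutral_right) (use S fin walk_entry_far in auto)
  also have "\<dots> = ?h S + sum ?h ?N"
    by (rule sum.insert) (use fin in auto)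
  also have "sum ?h ?N = (\<Sum>r\<in>M. ?c * (w r (r \<notin> S) * g (sym_diff S {r})))"
    unfolding sum.reindex[OF inj] o_def
    by (rule sum.cong) (simp_all only: walk_entry_flip[OF S] mult.assoc)
  also have "\<dots> = ?c * (\<Sum>r\<in>M. w r (r \<notin> S) * g (sym_diff S {r}))"
    by (rule sum_distrib_left[symmetric])
  finally have "sum ?h (Pow M) = (1 - ?c * (\<Sum>r\<in>M. w r (r \<notin> S))) * g S +
      ?c * (\<Sum>r\<in>M. w r (r \<notin> S) * g (sym_diff S {r}))"
    unfolding walk_entry_diag[OF S d] .
  moreover have "(\<Sum>r\<in>M. w r (r \<notin> S) * (g S - g (sym_diff S {r}))) =
      (\<Sum>r\<in>M. w r (r \<notin> S)) * g S - (\<Sum>r\<in>M. w r (r \<notin> S) * g (sym_diff S {r}))"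
    by (simp only: right_diff_distrib sum_subtractf sum_distrib_right)
  ultimately show ?thesis by (simp only: left_diff_distrib right_diff_distrib mult_1)
qed

text \<open>On pair \<open>r\<close>, with \<open>w = w r\<close>, the constant \<open>1\<close> and \<open>f\<close> with \<open>f False = w True\<close>, \<open>f True = - w False\<close> are
  eigenvectors of \<open>\<Pi>\<^sub>r\<close> for the eigenvalues \<open>1\<close> and \<open>0\<close>; their products diagonalize the walk.\<close>

lemma diagonalizable_walk_conf:
  assumes d: "d \<ge> 2"
  shows "diagonalizable_on (Pow M) (\<lambda>S T. walk_entry d \<psi> (conf S) (conf T))
    (\<lambda>S. 1 - real (card S) / real (d choose 2))"
proof -
  define f where "f r s = (if s then - w r False else w r True)" for r s
  define G where "G S U = (\<Prod>r\<in>U. f r (r \<in> S))" for S U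
  \<comment> \<open>On one pair the eigenvectors have the rows \<open>(1, w True)\<close> and
    \<open>(1, - w False)\<close>, with determinant \<open>- 1\<close>. The inverse has the rows
    \<open>(w False, w True)\<close> and \<open>(1, - 1)\<close>; \<open>H\<close> multiplies the
    first row over pairs outside \<open>U\<close> and the second over pairs in
    \<open>U\<close>.\<close>
  define H where "H U S = (\<Prod>r\<in>U. if r \<in> S then - 1 else 1) * (\<Prod>r\<in>M - U. w r (r \<in> S))" for U S
  show ?thesis
  proof (rule diagonalizable_onI[of _ _ G _ H])
    fix S U assume "S \<in> Pow M" "U \<in> Pow M"
    then have S: "S \<subseteq> M" and U: "U \<subseteq> M" by auto
    have finU: "finite U" using U fin by (rule finite_subset)
    \<comment> \<open>Resampling pair \<open>r\<close> annihilates the factor \<open>f r\<close> and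
      fixes a constant factor, so the difference has eigenvalue 1 for \<open>r \<in> U\<close> and 0
      otherwise. Summed over \<open>r\<close> this gives \<open>card U\<close>.\<close>
    have "w r (r \<notin> S) * (G S U - G (sym_diff S {r}) U) = (if r \<in> U then G S U else 0)"
      if r: "r \<in> M" for r
    proof (cases "r \<in> U")
      case True
      define c where "c = (\<Prod>t\<in>U - {r}. f t (t \<in> S))"
      have 1: "G S U = f r (r \<in> S) * c"
        unfolding G_def c_def using finU True by (rule prod.remove)
      have "G (sym_diff S {r}) U =
          f r (r \<in> sym_diff S {r}) * (\<Prod>t\<in>U - {r}. f t (t \<in> sym_diff S {r}))"
        unfolding G_def using finU True by (rule prod.remove)
      also have "(\<Prod>t\<in>U - {r}. f t (t \<in> sym_diff S {r})) = c"
        unfolding c_def by (rule prod.cong) auto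
      also have "(r \<in> sym_diff S {r}) = (r \<notin> S)" by auto
      finally have 2: "G (sym_diff S {r}) U = f r (r \<notin> S) * c" .
      have "w r (r \<notin> S) * (f r (r \<in> S) - f r (r \<notin> S)) = f r (r \<in> S)"
      proof (cases "r \<in> S")
        case True
        have "- w r False - w r True = - 1" using w_sum[OF r] by simp
        then show ?thesis using True by (simp add: f_def)
      next
        case False
        have "w r True + w r False = 1" using w_sum[OF r] by simp
        then show ?thesis using False by (simp add: f_def)
      qed
      then have "w r (r \<notin> S) * (f r (r \<in> S) - f r (r \<notin> S)) * c = f r (r \<in> S) * c" by simp
      then show ?thesis using True unfolding 1 2 by (simp add: algebra_simps)
    next
      case False
      have "G (sym_diff S {r}) U = G S U"
        unfolding G_def
      proof (rule prod.cong[OF refl])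
        fix t assume "t \<in> U"
        then have "t \<noteq> r" using False by blast
        then show "f t (t \<in> sym_diff S {r}) = f t (t \<in> S)" by simp
      qed
      then show ?thesis using False by simp
    qed
    then have "(\<Sum>r\<in>M. w r (r \<notin> S) * (G S U - G (sym_diff S {r}) U)) =
        (\<Sum>r\<in>M. if r \<in> U then G S U else 0)" by (rule sum.cong[OF refl])
    also have "\<dots> = real (card U) * G S U"
      using U fin by (simp add: sum.If_cases Int_absorb1)
    finally show "(\<Sum>T\<in>Pow M. walk_entry d \<psi> (conf S) (conf T) * G T U) =
        (1 - real (card U) / real (d choose 2)) * G S U"
      unfolding walk_entry_sum[OF S d] by (simp add: left_diff_distrib divide_inverse)
  next
    fix S T assume "S \<in> Pow M" "T \<in> Pow M"
    then have S: "S \<subseteq> M" and T: "T \<subseteq> M" by auto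
    have "(\<Sum>U\<in>Pow M. G S U * H U T) =
        (\<Sum>U\<in>Pow M. (\<Prod>r\<in>U. f r (r \<in> S) * (if r \<in> T then - 1 else 1)) * (\<Prod>r\<in>M - U. w r (r \<in> T)))"
      by (simp add: G_def H_def prod.distrib mult.assoc)
    \<comment> \<open>Each \<open>U\<close> records from which pairs the first summand is taken, so
      the sum is an expanded product. Its factors are entries of the product of the two inverse
      matrices of a single pair.\<close>
    also have "\<dots> = (\<Prod>r\<in>M. f r (r \<in> S) * (if r \<in> T then - 1 else 1) + w r (r \<in> T))"
      by (rule prod_add[symmetric]) (rule fin)
    also have "\<dots> = (\<Prod>r\<in>M. of_bool (r \<in> S \<longleftrightarrow> r \<in> T))"
    proof (rule prod.cong[OF refl])
      fix r assume r: "r \<in> M"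
      show "f r (r \<in> S) * (if r \<in> T then - 1 else 1) + w r (r \<in> T) =
          of_bool (r \<in> S \<longleftrightarrow> r \<in> T)"
        using w_sum[OF r] by (cases "r \<in> S"; cases "r \<in> T") (simp_all add: f_def)
    qed
    also have "\<dots> = of_bool (S = T)"
    proof (cases "S = T")
      case False
      then obtain r where "r \<in> M" "(r \<in> S) \<noteq> (r \<in> T)" using S T by blast
      then have "(\<Prod>r\<in>M. of_bool (r \<in> S \<longleftrightarrow> r \<in> T)) = (0::real)"
        using fin by (intro prod_zero) auto
      then show ?thesis using False by simp
    qed simp
    finally show "(\<Sum>U\<in>Pow M. G S U * H U T) = of_bool (S = T)" .
  qed
qed

section \<open>Spectrum, multiplicities and gap\<close>

text \<open>Eigenvalues are labelled by points of the support, hence the detour through the flip set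
  of \<open>x\<close>.\<close>

definition eig :: "bits \<Rightarrow> real" where
  "eig x = 1 - real (card (inv_into (Pow M) conf x)) / real (d choose 2)"

lemma eig_conf: "S \<subseteq> M \<Longrightarrow> eig (conf S) = 1 - real (card S) / real (d choose 2)"
  using bij_betw_imp_inj_on[OF bij_betw_conf] by (simp add: eig_def)

lemma diagonalizable_walk:
  assumes "d \<ge> 2"
  shows "diagonalizable_on (walk_states d \<psi>) (walk_entry d \<psi>) eig"
proof (rule diagonalizable_on_reindex[OF bij_betw_conf])
  show "diagonalizable_on (Pow M) (\<lambda>S T. walk_entry d \<psi> (conf S) (conf T)) (\<lambda>S. eig (conf S))"
    using diagonalizable_walk_conf[OF assms] unfolding diagonalizable_on_def
    by (simp add: eig_conf)
qed

lemma spectrum_walk: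
  assumes d: "d \<ge> 2"
  shows "spectrum (map_mat complex_of_real (walk_matrix d \<psi>)) =
    {complex_of_real (1 - real s / real (d choose 2)) | s. s \<in> {0..card M}}"
proof -
  have "spectrum (map_mat complex_of_real (walk_matrix d \<psi>)) =
      (\<lambda>x. complex_of_real (eig x)) ` conf ` Pow M"
    using spectrum_walk_matrix[OF diagonalizable_walk[OF d]] bij_betw_imp_surj_on[OF bij_betw_conf]
    by simp
  also have "\<dots> = (\<lambda>s. complex_of_real (1 - real s / real (d choose 2))) ` card ` Pow M"
    by (auto simp: image_image eig_conf intro!: image_cong)
  also have "card ` Pow M = {0..card M}"
  proof
    show "card ` Pow M \<subseteq> {0..card M}" using fin by (auto intro: card_mono)
    show "{0..card M} \<subseteq> card ` Pow M"
    proof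
      fix s assume "s \<in> {0..card M}"
      then obtain S where "S \<subseteq> M" "card S = s"
        using obtain_subset_with_card_n[of s M] by auto
      then show "s \<in> card ` Pow M" by auto
    qed
  qed
  finally show ?thesis by auto
qed

text \<open>Distinct \<open>s\<close> give distinct values \<open>1 - s/c\<close>, so the fibre of
  an eigenvalue consists of the flip sets with exactly \<open>s\<close> elements.\<close>

lemma order_walk:
  assumes d: "d \<ge> 2"
  shows "order (complex_of_real (1 - real s / real (d choose 2)))
    (char_poly (map_mat complex_of_real (walk_matrix d \<psi>))) = card M choose s"
proof -
  let ?e = "complex_of_real (1 - real s / real (d choose 2))"
  have finV: "finite (walk_states d \<psi>)" using walk_states_subset by (rule finite_subset) simp
  have c: "real (d choose 2) \<noteq> 0" using d by (simp add: binomial_eq_0_iff)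
  have "order ?e (char_poly (map_mat complex_of_real (walk_matrix d \<psi>))) =
      card {x \<in> walk_states d \<psi>. complex_of_real (eig x) = ?e}"
    unfolding char_poly_walk_matrix[OF diagonalizable_walk[OF d]]
    by (rule order_prod_linear) (rule finV)
  also have "{x \<in> walk_states d \<psi>. complex_of_real (eig x) = ?e} =
      conf ` {S. S \<subseteq> M \<and> card S = s}"
    unfolding bij_betw_imp_surj_on[OF bij_betw_conf, symmetric]
    using c by (auto simp: eig_conf)
  also have "card (conf ` {S. S \<subseteq> M \<and> card S = s}) = card {S. S \<subseteq> M \<and> card S = s}"
    by (rule card_image, rule inj_on_subset[OF bij_betw_imp_inj_on[OF bij_betw_conf]]) auto
  also have "\<dots> = card M choose s" using fin by (rule n_subsets)
  finally show ?thesis .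
qed

text \<open>The empty flip set gives the eigenvalue \<open>1\<close> and a singleton gives
  \<open>1 - 1/c\<close>. All other flip sets are nonempty and give no more, and the zeros from
  outside the support are no larger because \<open>c \<ge> 1\<close>.\<close>

lemma spectral_gap_L:
  assumes d: "d \<ge> 2" and "M \<noteq> {}"
  shows "spectral_gap (L_matrix d \<psi>) = 1 / real (d choose 2)"
proof -
  let ?c = "real (d choose 2)"
  define l where "l x = (if x \<in> walk_states d \<psi> then complex_of_real (eig x) else 0)" for x
  have c: "?c \<ge> 1" using d by (simp add: Suc_le_eq zero_less_binomial_iff)
  obtain r where r: "r \<in> M" using \<open>M \<noteq> {}\<close> by auto
  let ?u = "conf {}" and ?v = "conf {r}"
  have u: "?u \<in> walk_states d \<psi>" and v: "?v \<in> walk_states d \<psi>" using r by (auto intro: conf_mem)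
  have uv: "?u \<noteq> ?v"
    using bij_betw_imp_inj_on[OF bij_betw_conf] r by (auto dest: inj_onD)
  define R where "R = Pow {..<d} - {?u, ?v}"
  have "Pow {..<d} = insert ?u (insert ?v R)"
    using u v walk_states_subset[of d \<psi>] by (auto simp: R_def)
  moreover have "finite R" "?u \<notin> insert ?v R" "?v \<notin> R" using uv by (auto simp: R_def)
  ultimately have "mset_set (Pow {..<d}) = add_mset ?u (add_mset ?v (mset_set R))" by simp
  moreover have "proots (char_poly (L_matrix d \<psi>)) = image_mset l (mset_set (Pow {..<d}))"
  proof -
    have "char_poly (L_matrix d \<psi>) = (\<Prod>x\<in>Pow {..<d}. [:- l x, 1:])"
      unfolding l_def
      by (rule char_poly_L_matrix[OF diagonalizable_walk[OF d]]) (rule even_hamming)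
    then show ?thesis by (simp only: proots_prod_linear)
  qed
  ultimately have roots: "proots (char_poly (L_matrix d \<psi>)) =
      add_mset (l ?u) (add_mset (l ?v) (image_mset l (mset_set R)))" by simp
  have lu: "Re (l ?u) = 1" and lv: "Re (l ?v) = 1 - 1 / ?c"
    using u v r by (simp_all add: l_def eig_conf)
  have "Re (l x) \<le> 1 - 1 / ?c" if "x \<in> R" for x
  proof (cases "x \<in> walk_states d \<psi>")
    case True
    then obtain S where S: "S \<subseteq> M" "x = conf S" by (rule walk_statesE)
    then have "S \<noteq> {}" using that by (auto simp: R_def)
    then have "card S \<ge> 1" using S(1) fin by (simp add: Suc_le_eq card_gt_0_iff finite_subset)
    then have "1 / ?c \<le> real (card S) / ?c" using c by (intro divide_right_mono) auto
    then show ?thesis using S True by (simp add: l_def eig_conf)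
  next
    case False
    have "0 < ?c" using c by linarith
    then have "1 / ?c \<le> 1" by (simp only: divide_le_eq_1_pos c)
    then show ?thesis using False by (simp add: l_def)
  qed
  then have "eigenvalues_decreasing (L_matrix d \<psi>) ! 1 = Re (l ?v)"
    using roots lu lv c \<open>finite R\<close> by (intro eigenvalues_decreasing_nth_1[OF roots]) auto
  then show ?thesis by (simp add: spectral_gap_def lv)
qed

end

section \<open>Products of pair states as independent pair flips\<close>

theorem proposition1:
  fixes d m :: nat
    and a b :: "nat \<Rightarrow> nat"
    and \<alpha> \<beta> :: "nat \<Rightarrow> complex"
    and \<chi> :: "nat \<Rightarrow> amplitudes"
    and x :: bits
    and \<Psi> :: amplitudes
  assumes "d \<ge> 2" and "m \<ge> 1"
    and "\<And>r. r \<in> {1..m} \<Longrightarrow> a r < d \<and> b r < d \<and> a r \<noteq> b r"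
    and "disjoint_family_on (\<lambda>r. {a r, b r}) {1..m}"
    and "\<And>r. r \<in> {1..m} \<Longrightarrow>
           \<chi> r = odd_pair_state (a r) (b r) (\<alpha> r) (\<beta> r) \<or>
           \<chi> r = even_pair_state (a r) (b r) (\<alpha> r) (\<beta> r)"
    and "\<And>r. r \<in> {1..m} \<Longrightarrow> (cmod (\<alpha> r))\<^sup>2 + (cmod (\<beta> r))\<^sup>2 = 1"
    and "\<And>r. r \<in> {1..m} \<Longrightarrow> \<alpha> r * \<beta> r \<noteq> 0"
    and "x \<subseteq> {..<d} - (\<Union>r \<in> {1..m}. {a r, b r})"
    and "\<Psi> = pairs_product_state m (\<lambda>r. {a r, b r}) \<chi> x"
  shows "spectrum (map_mat complex_of_real (walk_matrix d \<Psi>)) =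
           {complex_of_real (1 - real s / real (d choose 2)) | s. s \<in> {0..m}}
       \<and> (\<forall>s \<in> {0..m}.
            order (complex_of_real (1 - real s / real (d choose 2)))
              (char_poly (map_mat complex_of_real (walk_matrix d \<Psi>))) = m choose s)
       \<and> spectral_gap (L_matrix d \<Psi>) = 1 / real (d choose 2)
       \<and> 1 / real (d choose 2) = 2 / (real d * (real d - 1))"
proof -
  define M where "M = {1..m}"
  define q where "q r = {a r, b r}" for r
  \<comment> \<open>The reference content of a pair, read off from the amplitude at
    \<open>{a r}\<close>: this set for an odd pair, the empty set for an even one. The complement
    within the pair is the other basis state.\<close>
  define p0 where "p0 r = (if \<chi> r {a r} \<noteq> 0 then {a r} else {})" for r
  define part where "part r s = (if s then q r - p0 r else p0 r)" for r s
  define w where "w r s = (cmod (\<chi> r (part r s)))\<^sup>2" for r s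
  define base where "base = x \<union> (\<Union>r\<in>M. p0 r)"
  have ab: "a r < d" "b r < d" "a r \<noteq> b r" if "r \<in> M" for r
    using assms(3) that by (auto simp: M_def)
  have uniq: "r = t" if "n \<in> q r" "n \<in> q t" "r \<in> M" "t \<in> M" for n r t
    using disjoint_family_onD[OF assms(4), of r t] that unfolding M_def q_def by blast
  have p0_sub: "p0 r \<subseteq> q r" for r by (simp add: p0_def q_def)
  have x_sub: "x \<subseteq> {..<d} - (\<Union>r\<in>M. q r)" using assms(8) by (simp only: M_def q_def)
  then have x_q: "x \<inter> q r = {}" if "r \<in> M" for r using that by blast
  have q_sub: "q r \<subseteq> {..<d}" if "r \<in> M" for r using ab[OF that] by (simp add: q_def)
  \<comment> \<open>All that is used about the pair states from here on; the distinction between odd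
    and even ends with this step.\<close>
  have pair: "(\<forall>u. u \<subseteq> q r \<longrightarrow> \<chi> r u \<noteq> 0 \<longrightarrow> u = p0 r \<or> u = q r - p0 r) \<and>
      \<chi> r (p0 r) \<noteq> 0 \<and> \<chi> r (q r - p0 r) \<noteq> 0 \<and>
      (cmod (\<chi> r (q r - p0 r)))\<^sup>2 + (cmod (\<chi> r (p0 r)))\<^sup>2 = 1" if r: "r \<in> M" for r
  proof -
    have nz: "\<alpha> r \<noteq> 0" "\<beta> r \<noteq> 0" using assms(7)[of r] r by (auto simp: M_def)
    have norm: "(cmod (\<alpha> r))\<^sup>2 + (cmod (\<beta> r))\<^sup>2 = 1" using assms(6)[of r] r by (auto simp: M_def)
    have "\<chi> r = odd_pair_state (a r) (b r) (\<alpha> r) (\<beta> r) \<or>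
        \<chi> r = even_pair_state (a r) (b r) (\<alpha> r) (\<beta> r)"
      using assms(5)[of r] r by (auto simp: M_def)
    then show ?thesis
    proof
      assume chi: "\<chi> r = odd_pair_state (a r) (b r) (\<alpha> r) (\<beta> r)"
      have p0: "p0 r = {a r}" using nz by (simp add: p0_def chi odd_pair_state_def)
      have p1: "q r - p0 r = {b r}" unfolding p0 q_def using ab[OF r] by auto
      show ?thesis unfolding p1 unfolding p0 chi odd_pair_state_def
        using nz norm ab[OF r] by (auto simp: add.commute)
    next
      assume chi: "\<chi> r = even_pair_state (a r) (b r) (\<alpha> r) (\<beta> r)"
      have p0: "p0 r = {}" using ab[OF r] by (auto simp: p0_def chi even_pair_state_def)
      have p1: "q r - p0 r = {a r, b r}" unfolding p0 q_def by auto
      show ?thesis unfolding p1 unfolding p0 chi even_pair_state_def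
        using nz norm ab[OF r] by (auto simp: add.commute)
    qed
  qed
  have \<Psi>: "\<Psi> y = (\<Prod>r\<in>M. \<chi> r (y \<inter> q r)) * of_bool (y - (\<Union>r\<in>M. q r) = x)" for y
    by (simp add: assms(9) pairs_product_state_def M_def q_def)
  define conf where "conf S = sym_diff base (\<Union>r\<in>S. q r)" for S
  have conf_q: "conf S \<inter> q r = part r (r \<in> S)" if S: "S \<subseteq> M" and r: "r \<in> M" for S r
  proof -
    have base: "base \<inter> q r = p0 r"
      using x_q[OF r] p0_sub uniq r unfolding base_def by blast
    have "(\<Union>r\<in>S. q r) \<inter> q r = (if r \<in> S then q r else {})"
      using uniq S r by auto
    then have "conf S \<inter> q r = sym_diff (p0 r) (if r \<in> S then q r else {})"
      unfolding conf_def using base by blast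
    then show ?thesis using p0_sub[of r] by (auto simp: part_def)
  qed
  have conf_x: "conf S - (\<Union>r\<in>M. q r) = x" if "S \<subseteq> M" for S
  proof -
    have "base - (\<Union>r\<in>M. q r) = x" using x_q p0_sub unfolding base_def by blast
    then show ?thesis using that unfolding conf_def by blast
  qed
  have prob: "basis_prob \<Psi> (conf S) = (\<Prod>r\<in>M. w r (r \<in> S))" if S: "S \<subseteq> M" for S
  proof -
    have "\<Psi> (conf S) = (\<Prod>r\<in>M. \<chi> r (conf S \<inter> q r))"
      unfolding \<Psi> conf_x[OF S] by simp
    also have "\<dots> = (\<Prod>r\<in>M. \<chi> r (part r (r \<in> S)))"
      by (rule prod.cong) (simp_all add: conf_q[OF S])
    finally show ?thesis
      by (simp add: basis_prob_def w_def prod_norm[symmetric] prod_power_distrib)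
  qed
  have w_pos: "w r s > 0" if "r \<in> M" for r s
    using pair[OF that] by (simp add: w_def part_def)
  have conf_sub: "conf S \<subseteq> {..<d}" if "S \<subseteq> M" for S
  proof -
    have "base \<subseteq> {..<d}" using x_sub p0_sub q_sub unfolding base_def by blast
    moreover have "(\<Union>r\<in>S. q r) \<subseteq> {..<d}" using that q_sub by blast
    ultimately show ?thesis unfolding conf_def by blast
  qed
  have states: "walk_states d \<Psi> = conf ` Pow M"
  proof
    show "conf ` Pow M \<subseteq> walk_states d \<Psi>"
    proof
      fix y assume "y \<in> conf ` Pow M"
      then obtain S where S: "S \<subseteq> M" "y = conf S" by auto
      have "(\<Prod>r\<in>M. w r (r \<in> S)) > 0" by (rule prod_pos) (use w_pos in auto)
      then show "y \<in> walk_states d \<Psi>"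
        using conf_sub[OF S(1)] prob[OF S(1)] by (simp add: walk_states_def S(2))
    qed
    show "walk_states d \<Psi> \<subseteq> conf ` Pow M"
    proof
      fix y assume "y \<in> walk_states d \<Psi>"
      then have "\<Psi> y \<noteq> 0" by (auto simp: walk_states_def basis_prob_def)
      then have y_x: "y - (\<Union>r\<in>M. q r) = x" and y_q: "\<And>r. r \<in> M \<Longrightarrow> \<chi> r (y \<inter> q r) \<noteq> 0"
        unfolding \<Psi> by (auto simp: M_def)
      \<comment> \<open>The pairs in which \<open>y\<close> departs from the reference; nonzero
        amplitude leaves only the complement \<open>q r - p0 r\<close> there.\<close>
      define S where "S = {r \<in> M. y \<inter> q r \<noteq> p0 r}"
      have S: "S \<subseteq> M" by (auto simp: S_def)
      have "y \<inter> q r = conf S \<inter> q r" if r: "r \<in> M" for r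
      proof -
        have "y \<inter> q r = p0 r \<or> y \<inter> q r = q r - p0 r"
          using pair[OF r] y_q[OF r] by (meson Int_lower2)
        then show ?thesis unfolding conf_q[OF S r] part_def using r by (auto simp: S_def)
      qed
      \<comment> \<open>The two strings agree on every pair and outside all pairs.\<close>
      then have "y = conf S" using y_x conf_x[OF S] by blast
      with S show "y \<in> conf ` Pow M" by blast
    qed
  qed
  interpret pair_flips d M q base w \<Psi>
  proof
    show "finite M" by (simp add: M_def)
    show "q r \<subseteq> {..<d}" "card (q r) = 2" if "r \<in> M" for r
      using ab[OF that] by (simp_all add: q_def)
    show "disjoint_family_on q M"
      using uniq unfolding disjoint_family_on_def by blast
    show "w r s > 0" if "r \<in> M" for r s using that by (rule w_pos)
    show "w r True + w r False = 1" if "r \<in> M" for r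
      using pair[OF that] by (simp add: w_def part_def)
    show "walk_states d \<Psi> = (\<lambda>S. sym_diff base (\<Union>r\<in>S. q r)) ` Pow M"
      using states unfolding conf_def .
    show "basis_prob \<Psi> (sym_diff base (\<Union>r\<in>S. q r)) = (\<Prod>r\<in>M. w r (r \<in> S))" if "S \<subseteq> M" for S
      using prob[OF that] unfolding conf_def .
  qed
  have card_M: "card M = m" and M: "M \<noteq> {}" using \<open>m \<ge> 1\<close> by (auto simp: M_def)
  have "1 / real (d choose 2) = 2 / (real d * (real d - 1))"
  proof -
    have "d choose 2 = d * (d - 1) div 2" by (rule choose_two)
    \<comment> \<open>Evenness makes the integer division by two exact, so it may be carried out
      over the reals.\<close>
    moreover have "even (d * (d - 1))" by (cases "even d") auto
    ultimately have c: "real (d choose 2) = real (d * (d - 1)) / 2" by (simp add: real_of_nat_div)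
    have "real (d - 1) = real d - 1" using \<open>d \<ge> 2\<close> by (simp add: of_nat_diff)
    then show ?thesis unfolding c by (simp only: of_nat_mult) simp
  qed
  then show ?thesis
    using spectrum_walk[OF \<open>d \<ge> 2\<close>] order_walk[OF \<open>d \<ge> 2\<close>] spectral_gap_L[OF \<open>d \<ge> 2\<close> M]
    unfolding card_M by blast
qed

end
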